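(* Let $C_+^{(4)}=\{(x_1,x_2)\in\mathbb{R}^2\colon 0<x_2<x_1\}$. Uniformly in $x=(x_1,x_2)\in C_+^{(4)}$, $y=(y_1,y_2)\in C_+^{(4)}$, and $t>0$, $$ p_t^{\eta_{\mathcal{N}_1},C_+^{(4)}}(x,y)\simeq\frac{x_1y_1}{x_1y_1+t}\cdot\frac{(x_1-x_2)(y_1-y_2)}{(x_1-x_2)(y_1-y_2)+t}\;p_t^{(2)}(x-y). $$
   Context: $p_t^{(2)}(w)=(4\pi t)^{-1}\exp(-\|w\|^2/4t)$, $w\in\mathbb{R}^2$, is the Gauss-Weierstrass kernel. Identify $\mathbb{R}^2\simeq\mathbb{C}$. The dihedral root system $I_2(4)$ is $\{e^{i\pi j/4}\colon j=0,\dots,7\}$, and $W=W(I_2(4))\subset O(2)$ is the group (of order 8) generated by the orthogonal reflections in the lines perpendicular to the vectors of $I_2(4)$; equivalently, $W$ consists of all maps $(x_1,x_2)\mapsto(\varepsilon_1x_1,\varepsilon_2x_2)$ and $(x_1,x_2)\mapsto(\varepsilon_1x_2,\varepsilon_2x_1)$ with $\varepsilon_1,\varepsilon_2\in\{1,-1\}$. The cone $C_+^{(4)}$ is a Weyl chamber for $I_2(4)$. For a homomorphism $\eta\colon W\to\{1,-1\}$, the $\eta$-heat kernel on $C_+^{(4)}$ is given, for $x,y\in C_+^{(4)}$ and $t>0$, by $$p_t^{\eta,C_+^{(4)}}(x,y)=\sum_{g\in W}\eta(g)\,p_t^{(2)}(gx-y).$$ The homomorphism $\eta_{\mathcal{N}_1}$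 is the one taking the value $1$ on all maps $(x_1,x_2)\mapsto(\varepsilon_1x_1,\varepsilon_2x_2)$ and the value $-1$ on all maps $(x_1,x_2)\mapsto(\varepsilon_1x_2,\varepsilon_2x_1)$; that is, it equals $1$ on the reflections in the coordinate axes and $-1$ on the reflections in the lines $x_2=\pm x_1$. The corresponding kernel is the heat kernel of the Laplacian on $C_+^{(4)}$ with the Dirichlet condition on the boundary half-line $\{(s,s)\colon s\ge0\}$ and the Neumann condition on the boundary half-line $\{(s,0)\colon s>0\}$. $X\simeq Y$ uniformly in the indicated variables means that there is a constant $C>0$, independent of $x,y,t$, with $C^{-1}Y\le X\le CY$. *)

theory Defs
  imports "HOL-Analysis.Analysis" "HOL-Algebra.Bij" "HOL-Algebra.Generated_Groups"
begin

definition gauss_weierstrass :: "real \<Rightarrow> real^2 \<Rightarrow> real" where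
  "gauss_weierstrass t w = 1 / (4 * pi * t) * exp (- (norm w)\<^sup>2 / (4 * t))"

text \<open>The point \<open>e\<^sup>i\<^sup>\<pi>\<^sup>j\<^sup>/\<^sup>4\<close> of the plane, as a vector of real coordinates.\<close>

definition root_I24 :: "nat \<Rightarrow> real^2" where
  "root_I24 j = vector [cos (pi * real j / 4), sin (pi * real j / 4)]"

definition root_system_I24 :: "(real^2) set" where
  "root_system_I24 = root_I24 ` {0..7}"

definition reflection :: "real^2 \<Rightarrow> real^2 \<Rightarrow> real^2" where
  "reflection a x = x - (2 * (x \<bullet> a) / (a \<bullet> a)) *\<^sub>R a"

definition W_I24 :: "(real^2 \<Rightarrow> real^2) set" where
  "W_I24 = generate (BijGroup UNIV) (reflection ` root_system_I24)"

definition chamber_I24 :: "(real^2) set" where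
  "chamber_I24 = {x. 0 < x$2 \<and> x$2 < x$1}"

definition sign_map :: "real \<Rightarrow> real \<Rightarrow> real^2 \<Rightarrow> real^2" where
  "sign_map e1 e2 x = vector [e1 * x$1, e2 * x$2]"

definition swap_map :: "real \<Rightarrow> real \<Rightarrow> real^2 \<Rightarrow> real^2" where
  "swap_map e1 e2 x = vector [e1 * x$2, e2 * x$1]"

text \<open>Only the values on \<^const>\<open>W_I24\<close> matter; there the second case means that the map is a
  \<^const>\<open>swap_map\<close>, see \<open>W_I24_eq\<close> and \<open>eta_N1_swap_map\<close>.\<close>

definition eta_N1 :: "(real^2 \<Rightarrow> real^2) \<Rightarrow> real" where
  "eta_N1 g = (if \<exists>e1\<in>{1, -1}. \<exists>e2\<in>{1, -1}. g = sign_map e1 e2 then 1 else -1)"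

definition eta_heat_kernel ::
    "((real^2 \<Rightarrow> real^2) \<Rightarrow> real) \<Rightarrow> real \<Rightarrow> real^2 \<Rightarrow> real^2 \<Rightarrow> real" where
  "eta_heat_kernel \<eta> t x y = (\<Sum>g\<in>W_I24. \<eta> g * gauss_weierstrass t (g x - y))"

lemma reflection_vector:
  assumes "c\<^sup>2 + s\<^sup>2 = 1"
  shows "reflection (vector [c, s]) x =
    vector [x$1 - 2 * (x$1 * c + x$2 * s) * c, x$2 - 2 * (x$1 * c + x$2 * s) * s]"
  using assms
  by (simp add: reflection_def vec_eq_iff forall_2 inner_vec_def sum_2 power2_eq_square)

lemma
  shows reflection_root_I24_0: "reflection (root_I24 0) = sign_map (-1) 1"
    and reflection_root_I24_1: "reflection (root_I24 1) = swap_map (-1) (-1)"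
    and reflection_root_I24_2: "reflection (root_I24 2) = sign_map 1 (-1)"
    and reflection_root_I24_3: "reflection (root_I24 3) = swap_map 1 1"
proof -
  have s2: "(sqrt 2 / 2) * (sqrt 2 / 2) = (1/2::real)" by simp
  have 3: "cos (pi * 3 / 4) = - (sqrt 2 / 2)" "sin (pi * 3 / 4) = sqrt 2 / 2"
    using cos_pi_minus[of "pi/4"] sin_pi_minus[of "pi/4"]
    by (simp_all add: cos_45 sin_45 field_simps)
  show "reflection (root_I24 0) = sign_map (-1) 1"
    by (rule ext) (simp add: root_I24_def reflection_vector sign_map_def vec_eq_iff forall_2)
  show "reflection (root_I24 2) = sign_map 1 (-1)"
    by (rule ext) (simp add: root_I24_def reflection_vector sign_map_def vec_eq_iff forall_2)
  show "reflection (root_I24 1) = swap_map (-1) (-1)"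
    by (rule ext) (simp add: root_I24_def reflection_vector swap_map_def vec_eq_iff forall_2
        cos_45 sin_45 power2_eq_square algebra_simps)
  show "reflection (root_I24 3) = swap_map 1 1"
    by (rule ext) (simp add: root_I24_def reflection_vector swap_map_def vec_eq_iff forall_2
        3 power2_eq_square algebra_simps)
qed

lemma reflection_root_I24_add: "reflection (root_I24 (j + 4)) = reflection (root_I24 j)"
proof -
  have "pi * real (j + 4) / 4 = pi * real j / 4 + pi"
    by (simp add: field_simps)
  then have "root_I24 (j + 4) = - root_I24 j"
    unfolding root_I24_def by (simp only: cos_periodic_pi sin_periodic_pi) (simp add: vec_eq_iff forall_2)
  then show ?thesis
    by (simp add: reflection_def fun_eq_iff)
qed

lemma reflections_I24:
  "reflection ` root_system_I24 =
    {sign_map (-1) 1, swap_map (-1) (-1), sign_map 1 (-1), swap_map 1 1}"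
proof -
  have "{0..7::nat} = {0, 1, 2, 3, 0 + 4, 1 + 4, 2 + 4, 3 + 4}" by auto
  then show ?thesis
    unfolding root_system_I24_def
    by (simp only: image_insert image_empty reflection_root_I24_add reflection_root_I24_0
        reflection_root_I24_1 reflection_root_I24_2 reflection_root_I24_3) auto
qed

lemma sign_swap_comp:
  "sign_map a b \<circ> sign_map c d = sign_map (a * c) (b * d)"
  "sign_map a b \<circ> swap_map c d = swap_map (a * c) (b * d)"
  "swap_map a b \<circ> sign_map c d = swap_map (a * d) (b * c)"
  "swap_map a b \<circ> swap_map c d = sign_map (a * d) (b * c)"
  by (simp_all add: fun_eq_iff sign_map_def swap_map_def vec_eq_iff forall_2)

lemma sign_map_1_1: "sign_map 1 1 = id"
  by (simp add: fun_eq_iff sign_map_def vec_eq_iff forall_2)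

lemma sign_map_eq_iff: "sign_map a b = sign_map c d \<longleftrightarrow> a = c \<and> b = d"
proof
  assume "sign_map a b = sign_map c d"
  then have "sign_map a b (vector [1, 1]) = sign_map c d (vector [1, 1])" by simp
  then show "a = c \<and> b = d" by (simp add: sign_map_def vec_eq_iff forall_2)
qed simp

lemma swap_map_eq_iff: "swap_map a b = swap_map c d \<longleftrightarrow> a = c \<and> b = d"
proof
  assume "swap_map a b = swap_map c d"
  then have "swap_map a b (vector [1, 1]) = swap_map c d (vector [1, 1])" by simp
  then show "a = c \<and> b = d" by (simp add: swap_map_def vec_eq_iff forall_2)
qed simp

lemma swap_map_neq_sign_map: "a \<noteq> 0 \<Longrightarrow> swap_map a b \<noteq> sign_map c d"
proof
  assume "a \<noteq> 0" "swap_map a b = sign_map c d"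
  then have "swap_map a b (vector [0, 1]) = sign_map c d (vector [0, 1])" by simp
  with \<open>a \<noteq> 0\<close> show False by (simp add: swap_map_def sign_map_def vec_eq_iff forall_2)
qed

lemma W_I24_eq:
  "W_I24 = {sign_map e1 e2 | e1 e2. e1 \<in> {1, -1} \<and> e2 \<in> {1, -1}} \<union>
           {swap_map e1 e2 | e1 e2. e1 \<in> {1, -1} \<and> e2 \<in> {1, -1}}" (is "_ = ?D")
proof -
  let ?B = "BijGroup (UNIV :: (real^2) set)"
  let ?R = "reflection ` root_system_I24"
  interpret group ?B by (rule group_BijGroup)
  have D: "?D = {sign_map 1 1, sign_map 1 (-1), sign_map (-1) 1, sign_map (-1) (-1),
                 swap_map 1 1, swap_map 1 (-1), swap_map (-1) 1, swap_map (-1) (-1)}"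
    by auto
  have carr: "carrier ?B = {f. bij f}"
    by (auto simp: BijGroup_def Bij_def)
  have mult: "f \<otimes>\<^bsub>?B\<^esub> g = f \<circ> g" if "bij f" "bij g" for f g
    using that by (auto simp: BijGroup_def Bij_def compose_def)
  have one: "\<one>\<^bsub>?B\<^esub> = id"
    by (auto simp: BijGroup_def)
  have bijD: "bij f" if "f \<in> ?D" for f
  proof -
    have "\<exists>g. f \<circ> g = id \<and> g \<circ> f = id"
    proof -
      from that consider a b where "f = sign_map a b" "a \<in> {1, -1}" "b \<in> {1, -1}"
        | a b where "f = swap_map a b" "a \<in> {1, -1}" "b \<in> {1, -1}" by blast
      then show ?thesis
      proof cases
        case 1
        then show ?thesis
          by (intro exI[of _ "sign_map a b"]) (auto simp: sign_swap_comp sign_map_1_1)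
      next
        case 2
        then show ?thesis
          by (intro exI[of _ "swap_map b a"]) (auto simp: sign_swap_comp sign_map_1_1)
      qed
    qed
    then show ?thesis by (metis o_bij)
  qed
  have RD: "?R \<subseteq> ?D"
    unfolding reflections_I24 D by auto
  have compD: "f \<circ> g \<in> ?D" if "f \<in> ?D" "g \<in> ?D" for f g
    using that unfolding D by (auto simp: sign_swap_comp)
  have invR: "inv\<^bsub>?B\<^esub> h = h" if "h \<in> ?R" for h
  proof (rule inv_equality)
    have "h \<in> ?D" using that RD by blast
    then have b: "bij h" by (rule bijD)
    then show "h \<in> carrier ?B" "h \<in> carrier ?B" by (auto simp: carr)
    show "h \<otimes>\<^bsub>?B\<^esub> h = \<one>\<^bsub>?B\<^esub>"
      using that b unfolding reflections_I24 one
      by (auto simp: mult sign_swap_comp sign_map_1_1)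
  qed
  have "W_I24 \<subseteq> ?D"
  proof
    fix f assume "f \<in> W_I24"
    then show "f \<in> ?D"
      unfolding W_I24_def
    proof (induction rule: generate.induct)
      case one
      have "sign_map 1 1 \<in> ?D" unfolding D by simp
      then show ?case by (simp only: \<open>\<one>\<^bsub>?B\<^esub> = id\<close> sign_map_1_1)
    next
      case (incl h)
      then show ?case using RD by blast
    next
      case (inv h)
      then show ?case using subsetD[OF RD] by (simp only: invR)
    next
      case (eng f g)
      then show ?case by (simp only: mult[OF bijD bijD] compD)
    qed
  qed
  moreover have "?D \<subseteq> W_I24"
  proof -
    have R: "h \<in> W_I24" if "h \<in> ?R" for h
      using that unfolding W_I24_def by (rule generate.incl)
    have r: "sign_map (-1) 1 \<in> W_I24" "swap_map (-1) (-1) \<in> W_I24"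
      "sign_map 1 (-1) \<in> W_I24" "swap_map 1 1 \<in> W_I24"
      by (auto intro!: R simp: reflections_I24)
    have comp: "f \<circ> g \<in> W_I24" if "f \<in> W_I24" "g \<in> W_I24" for f g
    proof -
      have "f \<otimes>\<^bsub>?B\<^esub> g \<in> W_I24"
        using that unfolding W_I24_def by (rule generate.eng)
      then show ?thesis
        by (simp only: mult[OF bijD[OF subsetD[OF \<open>W_I24 \<subseteq> ?D\<close> that(1)]]
              bijD[OF subsetD[OF \<open>W_I24 \<subseteq> ?D\<close> that(2)]]])
    qed
    have "sign_map 1 1 \<in> W_I24" "sign_map (-1) (-1) \<in> W_I24"
      "swap_map (-1) 1 \<in> W_I24" "swap_map 1 (-1) \<in> W_I24"
      using comp[OF r(1) r(1)] comp[OF r(1) r(3)] comp[OF r(1) r(4)] comp[OF r(3) r(4)]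
      by (simp_all add: sign_swap_comp)
    with r show ?thesis unfolding D by blast
  qed
  ultimately show ?thesis by (rule antisym)
qed

lemma eta_N1_sign_map: "e1 \<in> {1, -1} \<Longrightarrow> e2 \<in> {1, -1} \<Longrightarrow> eta_N1 (sign_map e1 e2) = 1"
  by (auto simp: eta_N1_def)

lemma eta_N1_swap_map: "e1 \<in> {1, -1} \<Longrightarrow> eta_N1 (swap_map e1 e2) = -1"
  using swap_map_neq_sign_map[of e1] by (auto simp: eta_N1_def)

lemma eta_N1_comp:
  assumes "g \<in> W_I24" "h \<in> W_I24"
  shows "eta_N1 (g \<circ> h) = eta_N1 g * eta_N1 h"
  using assms unfolding W_I24_eq
  by (auto simp: sign_swap_comp eta_N1_sign_map eta_N1_swap_map)

end

theory Submission
  imports Defs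
begin

text \<open>
  Put \<open>u = x\<^sub>1 + x\<^sub>2\<close>, \<open>v = x\<^sub>1 - x\<^sub>2\<close>, \<open>p = y\<^sub>1 + y\<^sub>2\<close>, \<open>q = y\<^sub>1 - y\<^sub>2\<close>. The elements of \<open>W\<close> are
  isometries, so after the common factor \<open>exp (-(\<parallel>x\<parallel>\<^sup>2 + \<parallel>y\<parallel>\<^sup>2) / 4t)\<close> is taken out, the alternating sum
  is one of exponentials of inner products. In terms of
  \<open>A = up/4t\<close>, \<open>B = vq/4t\<close>, \<open>C = uq/4t\<close>, \<open>D = vp/4t\<close> the eight exponents are \<open>\<plusminus>(A + B)\<close> and
  \<open>\<plusminus>(C + D)\<close> with sign \<open>+1\<close>, and \<open>\<plusminus>(A - B)\<close> and \<open>\<plusminus>(C - D)\<close> with sign \<open>-1\<close>. The addition theorem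
  for \<open>cosh\<close> turns the difference into a sum of products, in which all cancellation has
  disappeared because all four arguments are positive on the chamber:
  \<open>4 p\<^sub>t(x - y) exp (-(A + B)) (sinh A sinh B + sinh C sinh D)\<close>
  (lemma \<open>eta_heat_kernel_N1_sinh\<close>).

  The first product dominates the second. Indeed \<open>sinh z\<close> is comparable to
  \<open>z / (1 + z) * exp z\<close> for \<open>z \<ge> 0\<close>, and since \<open>AB = CD\<close> and \<open>C + D \<le> A + B\<close>, the
  product of the comparison functions at \<open>C, D\<close> is at most that at \<open>A, B\<close>
  (lemma \<open>sinh_bound_mult_mono\<close>). Hence the kernel is comparable to
  \<open>A / (1 + A) * (B / (1 + B)) * p\<^sub>t(x - y)\<close>. Finally \<open>x\<^sub>1y\<^sub>1 \<le> up \<le> 4x\<^sub>1y\<^sub>1\<close>, so the two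
  fractions are comparable to those in the claim.
\<close>

section \<open>The kernel as a sum of positive products\<close>

text \<open>The vectors \<open>w\<close> of interest are the points \<open>g x\<close> of one orbit, which all have the same norm:
  only the last factor depends on \<open>g\<close>.\<close>

lemma gauss_weierstrass_vector_diff:
  fixes y :: "real^2"
  assumes "t > 0"
  shows "gauss_weierstrass t (vector [a, b] - y) =
    1 / (4 * pi * t) * exp (- (a\<^sup>2 + b\<^sup>2 + (y$1)\<^sup>2 + (y$2)\<^sup>2) / (4 * t))
      * exp ((a * y$1 + b * y$2) / (2 * t))"
proof -
  have "(norm (vector [a, b] - y))\<^sup>2 = (a - y$1)\<^sup>2 + (b - y$2)\<^sup>2"
    unfolding power2_norm_eq_inner
    by (simp add: inner_vec_def sum_2 power2_eq_square)
  moreover have "- ((a - y$1)\<^sup>2 + (b - y$2)\<^sup>2) / (4 * t) =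
      - (a\<^sup>2 + b\<^sup>2 + (y$1)\<^sup>2 + (y$2)\<^sup>2) / (4 * t) + (a * y$1 + b * y$2) / (2 * t)"
    using assms by (simp add: power2_eq_square field_simps)
  ultimately show ?thesis
    unfolding gauss_weierstrass_def by (simp add: exp_add)
qed

lemma sum_W_I24:
  "(\<Sum>g\<in>W_I24. f g) =
    f (sign_map 1 1) + f (sign_map 1 (-1)) + f (sign_map (-1) 1) + f (sign_map (-1) (-1)) +
    f (swap_map 1 1) + f (swap_map 1 (-1)) + f (swap_map (-1) 1) + f (swap_map (-1) (-1))"
  for f :: "_ \<Rightarrow> real"
proof -
  have W: "W_I24 = {sign_map 1 1, sign_map 1 (-1), sign_map (-1) 1, sign_map (-1) (-1),
                 swap_map 1 1, swap_map 1 (-1), swap_map (-1) 1, swap_map (-1) (-1)}"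
    unfolding W_I24_eq by auto
  have "sign_map a b \<noteq> swap_map 1 d" "sign_map a b \<noteq> swap_map (- 1) d" for a b d
    using swap_map_neq_sign_map[of 1 d a b] swap_map_neq_sign_map[of "- 1" d a b] by auto
  then show ?thesis
    unfolding W by (simp add: sign_map_eq_iff swap_map_eq_iff)
qed

lemma cosh_add_minus_cosh_diff: "cosh (a + b) - cosh (a - b) = 2 * sinh a * sinh b"
  for a b :: real
  by (simp add: cosh_add cosh_diff)

text \<open>The map \<open>x \<mapsto> (u, v)\<close> is, up to a factor, the reflection exchanging the two families of
  mirrors. It is chosen because \<open>u\<close> and \<open>v\<close> are positive on the chamber and the inner products
  \<open>gx \<bullet> y\<close> become half the sums and differences of \<open>up, vq\<close> and of \<open>uq, vp\<close>.\<close>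

lemma eta_heat_kernel_N1_sinh:
  fixes x y :: "real^2"
  assumes t: "t > 0"
  defines "A \<equiv> (x$1 + x$2) * (y$1 + y$2) / (4 * t)"
    and "B \<equiv> (x$1 - x$2) * (y$1 - y$2) / (4 * t)"
    and "C \<equiv> (x$1 + x$2) * (y$1 - y$2) / (4 * t)"
    and "D \<equiv> (x$1 - x$2) * (y$1 + y$2) / (4 * t)"
  shows "eta_heat_kernel eta_N1 t x y =
    4 * gauss_weierstrass t (x - y) * exp (- (A + B)) * (sinh A * sinh B + sinh C * sinh D)"
proof -
  define N where
    "N = 1 / (4 * pi * t) * exp (- ((x$1)\<^sup>2 + (x$2)\<^sup>2 + (y$1)\<^sup>2 + (y$2)\<^sup>2) / (4 * t))"
  have orbit: "gauss_weierstrass t (vector [a, b] - y) = N * exp r"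
    if "a\<^sup>2 + b\<^sup>2 = (x$1)\<^sup>2 + (x$2)\<^sup>2" "(a * y$1 + b * y$2) / (2 * t) = r" for a b r
    unfolding gauss_weierstrass_vector_diff[OF t] N_def by (simp only: that)
  have sign:
    "gauss_weierstrass t (sign_map 1 1 x - y) = N * exp (A + B)"
    "gauss_weierstrass t (sign_map 1 (-1) x - y) = N * exp (C + D)"
    "gauss_weierstrass t (sign_map (-1) 1 x - y) = N * exp (- (C + D))"
    "gauss_weierstrass t (sign_map (-1) (-1) x - y) = N * exp (- (A + B))"
    unfolding sign_map_def A_def B_def C_def D_def
    by (rule orbit; use t in \<open>simp add: field_simps\<close>)+
  have swap:
    "gauss_weierstrass t (swap_map 1 1 x - y) = N * exp (A - B)"
    "gauss_weierstrass t (swap_map 1 (-1) x - y) = N * exp (C - D)"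
    "gauss_weierstrass t (swap_map (-1) 1 x - y) = N * exp (- (C - D))"
    "gauss_weierstrass t (swap_map (-1) (-1) x - y) = N * exp (- (A - B))"
    unfolding swap_map_def A_def B_def C_def D_def
    by (rule orbit; use t in \<open>simp add: field_simps\<close>)+
  have "eta_heat_kernel eta_N1 t x y =
      2 * N * ((cosh (A + B) - cosh (A - B)) + (cosh (C + D) - cosh (C - D)))"
    unfolding eta_heat_kernel_def sum_W_I24 sign swap cosh_field_def
    by (simp add: eta_N1_sign_map eta_N1_swap_map field_simps)
  also have "\<dots> = 4 * N * (sinh A * sinh B + sinh C * sinh D)"
    unfolding cosh_add_minus_cosh_diff by (simp add: algebra_simps)
  also have "N = gauss_weierstrass t (x - y) * exp (- (A + B))"
    unfolding sign(1)[unfolded sign_map_1_1 id_apply] mult.assoc exp_add[symmetric] by simp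
  finally show ?thesis by simp
qed

section \<open>Size of the hyperbolic sine\<close>

definition sinh_bound :: "real \<Rightarrow> real" where
  "sinh_bound z = z / (1 + z) * exp z"

lemma sinh_bound_nonneg: "z \<ge> 0 \<Longrightarrow> sinh_bound z \<ge> 0"
  by (simp add: sinh_bound_def)

text \<open>Both estimates concern \<open>1 - exp (-2z) = 2 exp (-z) sinh z\<close>. The lower one is
  \<open>exp (2z) \<ge> 1 + 2z \<ge> 1 + z\<close>; the upper one multiplies by \<open>1 + z\<close> and bounds the factor by \<open>2z\<close> in the
  first summand and by \<open>1\<close> in the second.\<close>

lemma
  fixes z :: real
  assumes z: "z \<ge> 0"
  shows sinh_ge_sinh_bound: "sinh_bound z / 2 \<le> sinh z"
    and sinh_le_sinh_bound: "sinh z \<le> 3 / 2 * sinh_bound z"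
proof -
  have sinh: "sinh z = (1 - exp (-2 * z)) / 2 * exp z"
  proof -
    have "exp (-2 * z) * exp z = exp (- z)"
      by (simp flip: exp_add)
    then show ?thesis by (simp add: sinh_field_def algebra_simps)
  qed
  have lower: "z / (1 + z) \<le> 1 - exp (-2 * z)"
  proof -
    have "exp (-2 * z) = 1 / exp (2 * z)"
      by (simp add: exp_minus field_simps)
    also have "\<dots> \<le> 1 / (1 + z)"
    proof (intro divide_left_mono)
      show "1 + z \<le> exp (2 * z)"
        using z exp_ge_add_one_self[of "2 * z"] by linarith
    qed (use z in auto)
    finally show ?thesis using z by (simp add: field_simps)
  qed
  have upper: "1 - exp (-2 * z) \<le> 3 * (z / (1 + z))"
  proof -
    have "1 - exp (-2 * z) \<le> 2 * z"
      using exp_ge_add_one_self[of "-2 * z"] by simp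
    moreover have "z * (1 - exp (-2 * z)) \<le> z * 1"
      using z by (intro mult_left_mono) auto
    ultimately have "(1 + z) * (1 - exp (-2 * z)) \<le> 3 * z"
      by (simp add: algebra_simps)
    then show ?thesis using z by (simp add: field_simps)
  qed
  show "sinh_bound z / 2 \<le> sinh z"
    using mult_right_mono[OF lower, of "exp z / 2"]
    by (simp add: sinh sinh_bound_def)
  show "sinh z \<le> 3 / 2 * sinh_bound z"
    using mult_right_mono[OF upper, of "exp z / 2"]
    by (simp add: sinh sinh_bound_def mult_ac)
qed

text \<open>With fixed product, spreading the arguments by \<open>h = (a + b) - (c + d)\<close> raises the
  exponential by the factor \<open>exp h\<close>, and the denominator \<open>(1 + c) (1 + d)\<close> only by
  the summand \<open>h\<close>, thus at most by the factor \<open>1 + h \<le> exp h\<close>.\<close>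

lemma sinh_bound_mult_mono:
  assumes nonneg: "a \<ge> 0" "b \<ge> 0" "c \<ge> 0" "d \<ge> 0"
    and prod: "c * d = a * b" and sum: "c + d \<le> a + b"
  shows "sinh_bound c * sinh_bound d \<le> sinh_bound a * sinh_bound b"
proof -
  define h where "h = (a + b) - (c + d)"
  define M where "M = (1 + c) * (1 + d)"
  have h: "h \<ge> 0" using sum by (simp add: h_def)
  have M: "M \<ge> 1"
    using nonneg by (simp add: M_def algebra_simps)
  have ab: "(1 + a) * (1 + b) = M + h"
    using prod by (simp add: M_def h_def algebra_simps)
  have "M + h \<le> M * (1 + h)"
    using mult_right_mono[OF M h] by (simp add: algebra_simps)
  also have "\<dots> \<le> M * exp h"
    using M exp_ge_add_one_self[of h] by (intro mult_left_mono) auto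
  finally have "1 / M \<le> exp h / (M + h)"
    using M h by (simp add: field_simps)
  then have "(a * b * exp (c + d)) * (1 / M) \<le> (a * b * exp (c + d)) * (exp h / (M + h))"
    using nonneg by (intro mult_left_mono) auto
  also have "\<dots> = a * b * exp (a + b) / (M + h)"
    by (simp add: h_def flip: exp_add)
  finally have "c * d * exp (c + d) / ((1 + c) * (1 + d)) \<le>
      a * b * exp (a + b) / ((1 + a) * (1 + b))"
    unfolding ab prod by (simp add: M_def)
  then show ?thesis
    by (simp add: sinh_bound_def exp_add mult_ac)
qed

lemma
  assumes nonneg: "a \<ge> 0" "b \<ge> 0" "c \<ge> 0" "d \<ge> 0"
    and prod: "c * d = a * b" and sum: "c + d \<le> a + b"
  shows sinh_mult_sum_ge: "sinh_bound a * sinh_bound b / 4 \<le> sinh a * sinh b + sinh c * sinh d"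
    and sinh_mult_sum_le: "sinh a * sinh b + sinh c * sinh d \<le> 9 / 2 * (sinh_bound a * sinh_bound b)"
proof -
  have "sinh_bound a / 2 * (sinh_bound b / 2) \<le> sinh a * sinh b"
    using nonneg by (intro mult_mono sinh_ge_sinh_bound) (simp_all add: sinh_bound_nonneg)
  moreover have "0 \<le> sinh c * sinh d"
    using nonneg by simp
  ultimately show "sinh_bound a * sinh_bound b / 4 \<le> sinh a * sinh b + sinh c * sinh d"
    by simp
  have "sinh r * sinh s \<le> (3 / 2 * sinh_bound r) * (3 / 2 * sinh_bound s)"
    if "r \<ge> 0" "s \<ge> 0" for r s
    using that by (intro mult_mono sinh_le_sinh_bound) (simp_all add: sinh_bound_nonneg)
  from this[of a b] this[of c d] sinh_bound_mult_mono[OF assms] nonneg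
  show "sinh a * sinh b + sinh c * sinh d \<le> 9 / 2 * (sinh_bound a * sinh_bound b)"
    by simp
qed

section \<open>Comparison with the claimed expression\<close>

text \<open>The middle term is \<open>m / (m + 4t)\<close>, which increases with \<open>m\<close>: at \<open>m = 4r\<close> it equals the upper
  bound, and at \<open>m = r\<close> replacing \<open>r + 4t\<close> by \<open>4 (r + t)\<close> costs the factor \<open>4\<close>.\<close>

lemma
  fixes m r t :: real
  assumes t: "t > 0" and r: "0 < r" "r \<le> m" "m \<le> 4 * r"
  shows saturation_ge: "r / (r + t) / 4 \<le> m / (4 * t) / (1 + m / (4 * t))"
    and saturation_le: "m / (4 * t) / (1 + m / (4 * t)) \<le> r / (r + t)"
proof -
  have eq: "m / (4 * t) / (1 + m / (4 * t)) = m / (m + 4 * t)"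
    using t r by (simp add: field_simps)
  have "r * m + r * (4 * t) \<le> m * (4 * r) + m * (4 * t)"
    using t r by (intro add_mono mult_right_mono) (simp_all add: mult.commute[of r m])
  then show "r / (r + t) / 4 \<le> m / (4 * t) / (1 + m / (4 * t))"
    unfolding eq using t r by (simp add: field_simps)
  have "m * t \<le> 4 * r * t"
    using t r by (intro mult_right_mono) simp_all
  then show "m / (4 * t) / (1 + m / (4 * t)) \<le> r / (r + t)"
    unfolding eq using t r by (simp add: field_simps)
qed

theorem proposition4p2:
  shows "\<exists>C>0. \<forall>x\<in>chamber_I24. \<forall>y\<in>chamber_I24. \<forall>t>0.
    (let X = eta_heat_kernel eta_N1 t x y;
         Y = (x$1 * y$1) / (x$1 * y$1 + t)
           * (((x$1 - x$2) * (y$1 - y$2)) / ((x$1 - x$2) * (y$1 - y$2) + t))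
           * gauss_weierstrass t (x - y)
     in inverse C * Y \<le> X \<and> X \<le> C * Y)"
proof -
  \<comment> \<open>Above, \<open>18\<close> is the factor \<open>4\<close> of the kernel times \<open>9/2\<close>. Below, the factor \<open>4\<close> cancels the \<open>1/4\<close>
    from the two hyperbolic sines, and the two fractions lose \<open>1/16\<close>, which is more than \<open>1/18\<close>.\<close>
  have main: "inverse 18 * (r / (r + t) * (m' / (m' + t)) * G) \<le> X \<and>
      X \<le> 18 * (r / (r + t) * (m' / (m' + t)) * G)"
    if x: "x \<in> chamber_I24" and y: "y \<in> chamber_I24" and t: "t > 0"
      and defs: "r = x$1 * y$1" "m' = (x$1 - x$2) * (y$1 - y$2)"
        "G = gauss_weierstrass t (x - y)" "X = eta_heat_kernel eta_N1 t x y"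
    for x y :: "real^2" and t r m' G X :: real
  proof -
    define m where "m = (x$1 + x$2) * (y$1 + y$2)"
    define a b c d where "a = m / (4 * t)" and "b = m' / (4 * t)"
      and "c = (x$1 + x$2) * (y$1 - y$2) / (4 * t)"
      and "d = (x$1 - x$2) * (y$1 + y$2) / (4 * t)"
    note abcd = a_def b_def c_def d_def m_def defs
    have xy: "0 < x$2" "x$2 < x$1" "0 < y$2" "y$2 < y$1"
      using x y by (auto simp: chamber_I24_def)
    have pos: "a \<ge> 0" "b \<ge> 0" "c \<ge> 0" "d \<ge> 0"
      unfolding abcd using xy t by simp_all
    have "c * d = a * b" unfolding abcd by simp
    moreover have "c + d \<le> a + b"
    proof -
      have "(a + b) - (c + d) = x$2 * y$2 / t"
        unfolding abcd using t by (simp add: field_simps)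
      moreover have "x$2 * y$2 / t \<ge> 0"
        using xy t by simp
      ultimately show ?thesis by linarith
    qed
    ultimately have S:
      "sinh_bound a * sinh_bound b / 4 \<le> sinh a * sinh b + sinh c * sinh d"
      "sinh a * sinh b + sinh c * sinh d \<le> 9 / 2 * (sinh_bound a * sinh_bound b)"
      using pos by (blast intro: sinh_mult_sum_ge sinh_mult_sum_le)+

    define E where "E = 4 * G * exp (- (a + b))"
    have G: "G \<ge> 0" and E: "E \<ge> 0"
      using t by (simp_all add: E_def defs gauss_weierstrass_def)
    have X: "X = E * (sinh a * sinh b + sinh c * sinh d)"
      using eta_heat_kernel_N1_sinh[OF t, of x y] by (simp add: E_def abcd)
    define Z where "Z = a / (1 + a) * (b / (1 + b))"
    have EZ: "E * (sinh_bound a * sinh_bound b) = 4 * (Z * G)"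
    proof -
      have "exp (- (a + b)) * (exp a * exp b) = 1"
        by (simp flip: exp_add)
      moreover have "E * (sinh_bound a * sinh_bound b) =
          4 * (Z * G) * (exp (- (a + b)) * (exp a * exp b))"
        unfolding E_def Z_def sinh_bound_def by (simp only: mult_ac)
      ultimately show ?thesis by simp
    qed
    have ZX: "Z * G \<le> X" "X \<le> 18 * (Z * G)"
      using mult_left_mono[OF S(1) E] mult_left_mono[OF S(2) E] EZ
      unfolding X by simp_all

    have r: "0 < r" "r \<le> m" "m \<le> 4 * r"
    proof -
      show "0 < r" using xy by (simp add: defs)
      show "r \<le> m" unfolding defs m_def using xy by (intro mult_mono) simp_all
      have "m \<le> (2 * x$1) * (2 * y$1)"
        unfolding m_def using xy by (intro mult_mono) simp_all
      then show "m \<le> 4 * r" by (simp add: defs)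
    qed
    have m': "0 < m'" "m' \<le> 4 * m'"
      using xy by (simp_all add: defs)
    define Y where "Y = r / (r + t) * (m' / (m' + t)) * G"
    have "Y / 16 = r / (r + t) / 4 * (m' / (m' + t) / 4) * G"
      unfolding Y_def by (simp only: times_divide_eq_left times_divide_eq_right) simp
    also have "\<dots> \<le> Z * G"
      unfolding Z_def a_def b_def using t r m' pos G
      by (intro mult_right_mono mult_mono saturation_ge) simp_all
    finally have "Y / 16 \<le> Z * G" .
    moreover have "Z * G \<le> Y"
      unfolding Y_def Z_def a_def b_def using t r m' G
      by (intro mult_right_mono mult_mono saturation_le) simp_all
    moreover have "0 \<le> Y"
      using t r m' G by (simp add: Y_def)
    ultimately show ?thesis
      using ZX unfolding Y_def[symmetric] by simp
  qed
  show ?thesis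
    unfolding Let_def
    by (rule exI[of _ 18]) (use main in simp)
qed

end
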